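(* There exists a transitive nonunimodular graph $G$ such that every level of $G$ induces a connected subgraph. More precisely, there exists a transitive nonunimodular graph $G$ such that every level of $G$ induces a subgraph isomorphic to the Diestel–Leader graph $DL(2,2)$ and (with the weight function suitably normalized) the weights of all levels are integer powers of $4$.
   Context: All graphs are locally finite; transitive graphs are infinite and connected. $\mathrm{Aut}(G)$ is the automorphism group of $G$, and $S_x=\{g\in \mathrm{Aut}(G): g(x)=x\}$ is the stabilizer of a vertex $x$. A transitive graph $G$ is unimodular if $|S_xy|=|S_yx|$ for all $x,y\in V(G)$; otherwise it is nonunimodular. Fix a vertex $o$; the weight of $x\in V(G)$ is $w(x)=|S_xo|/|S_ox|$ (independent of $o$ up to a constant factor; it satisfies $|S_xy|/|S_yx|=w(x)/w(y)$). A level of $G$ is a maximal set of vertices any two of which satisfy $|S_xy|=|S_yx|$; all its vertices have the same weight, called the weight of the level. The Diestel–Leader graph $DL(2,2)$: let $T$ and $T'$ be $3$-regular trees whose vertices are arranged into layers indexed by $\mathbb{Z}$ so that a vertex of $T$ on layer $i$ has $2$ neighbors (its children) on layer $i+1$ and one neighbor (its parent) on layer $i-1$, and a vertex of $T'$ on layer $i$ has $2$ neighbors (its children) on layer $i-1$ and one neighbor (its parent) on layer $i+1$. Write $l_T,l_{T'}$ for the layer functions. The vertex set of $DL(2,2)$ is $\{(x,x')\in V(T)\times V(T'): l_T(x)=l_{T'}(x')\}$, with $(x,x')$ and $(y,y')$ adjacent iff $x,y$ are adjacent in $T$ and $x',y'$ are adjacent in $T'$. *)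

theory Defs
  imports Complex_Main "HOL-Combinatorics.Permutations"
begin

record 'a graph =
  verts :: "'a set"
  adj :: "'a \<Rightarrow> 'a \<Rightarrow> bool"

definition simple_graph :: "'a graph \<Rightarrow> bool" where
  "simple_graph G \<longleftrightarrow>
     (\<forall>x y. adj G x y \<longrightarrow> x \<in> verts G \<and> y \<in> verts G \<and> x \<noteq> y \<and> adj G y x)"

definition locally_finite_graph :: "'a graph \<Rightarrow> bool" where
  "locally_finite_graph G \<longleftrightarrow> (\<forall>x\<in>verts G. finite {y. adj G x y})"

definition connected_graph :: "'a graph \<Rightarrow> bool" where
  "connected_graph G \<longleftrightarrow>
     verts G \<noteq> {} \<and> (\<forall>x\<in>verts G. \<forall>y\<in>verts G. (adj G)\<^sup>*\<^sup>* x y)"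

definition induced_subgraph :: "'a graph \<Rightarrow> 'a set \<Rightarrow> 'a graph" where
  "induced_subgraph G L = \<lparr>verts = L, adj = (\<lambda>x y. x \<in> L \<and> y \<in> L \<and> adj G x y)\<rparr>"

definition isomorphic_graphs :: "'a graph \<Rightarrow> 'b graph \<Rightarrow> bool" where
  "isomorphic_graphs G H \<longleftrightarrow>
     (\<exists>f. bij_betw f (verts G) (verts H) \<and>
          (\<forall>x\<in>verts G. \<forall>y\<in>verts G. adj H (f x) (f y) \<longleftrightarrow> adj G x y))"

(* permutes makes an automorphism the identity off the vertex set, so that
   automorphisms are determined by their action on vertices. *)
definition Aut :: "'a graph \<Rightarrow> ('a \<Rightarrow> 'a) set" where
  "Aut G = {g. g permutes verts G \<and>
               (\<forall>x\<in>verts G. \<forall>y\<in>verts G. adj G (g x) (g y) \<longleftrightarrow> adj G x y)}"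

definition stabilizer :: "'a graph \<Rightarrow> 'a \<Rightarrow> ('a \<Rightarrow> 'a) set" where
  "stabilizer G x = {g \<in> Aut G. g x = x}"

(* The set written S_x y. It is finite if G is connected and locally finite, because
   S_x preserves distances to x; so taking its card below loses nothing. *)
definition stab_orbit :: "'a graph \<Rightarrow> 'a \<Rightarrow> 'a \<Rightarrow> 'a set" where
  "stab_orbit G x y = (\<lambda>g. g y) ` stabilizer G x"

definition transitive_graph :: "'a graph \<Rightarrow> bool" where
  "transitive_graph G \<longleftrightarrow>
     simple_graph G \<and> locally_finite_graph G \<and> infinite (verts G) \<and> connected_graph G \<and>
     (\<forall>x\<in>verts G. \<forall>y\<in>verts G. \<exists>g\<in>Aut G. g x = y)"

definition unimodular :: "'a graph \<Rightarrow> bool" where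
  "unimodular G \<longleftrightarrow>
     (\<forall>x\<in>verts G. \<forall>y\<in>verts G. card (stab_orbit G x y) = card (stab_orbit G y x))"

definition weight :: "'a graph \<Rightarrow> 'a \<Rightarrow> 'a \<Rightarrow> real" where
  "weight G b x = real (card (stab_orbit G x b)) / real (card (stab_orbit G b x))"

definition equal_weight_set :: "'a graph \<Rightarrow> 'a set \<Rightarrow> bool" where
  "equal_weight_set G L \<longleftrightarrow>
     L \<subseteq> verts G \<and>
     (\<forall>x\<in>L. \<forall>y\<in>L. card (stab_orbit G x y) = card (stab_orbit G y x))"

definition is_level :: "'a graph \<Rightarrow> 'a set \<Rightarrow> bool" where
  "is_level G L \<longleftrightarrow>
     equal_weight_set G L \<and> (\<forall>M. equal_weight_set G M \<longrightarrow> L \<subseteq> M \<longrightarrow> M = L)"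

definition is_cycle :: "'a graph \<Rightarrow> 'a list \<Rightarrow> bool" where
  "is_cycle G xs \<longleftrightarrow>
     length xs \<ge> 3 \<and> distinct xs \<and> successively (adj G) xs \<and> adj G (last xs) (hd xs)"

definition tree_graph :: "'a graph \<Rightarrow> bool" where
  "tree_graph T \<longleftrightarrow> simple_graph T \<and> connected_graph T \<and> (\<nexists>xs. is_cycle T xs)"

(* s = 1: children lie one layer above their parent (the tree T);
   s = -1: children lie one layer below their parent (the tree T'). *)
definition layered_tree :: "int \<Rightarrow> 'a graph \<Rightarrow> ('a \<Rightarrow> int) \<Rightarrow> bool" where
  "layered_tree s T l \<longleftrightarrow>
     tree_graph T \<and>
     (\<forall>x\<in>verts T. card {y. adj T x y} = 3 \<and>
                  card {y. adj T x y \<and> l y = l x + s} = 2 \<and>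
                  card {y. adj T x y \<and> l y = l x - s} = 1)"

definition DL_graph ::
  "'a graph \<Rightarrow> ('a \<Rightarrow> int) \<Rightarrow> 'b graph \<Rightarrow> ('b \<Rightarrow> int) \<Rightarrow> ('a \<times> 'b) graph" where
  "DL_graph T l T' l' =
     (let V = {(x, x'). x \<in> verts T \<and> x' \<in> verts T' \<and> l x = l' x'}
      in \<lparr>verts = V,
          adj = (\<lambda>p q. p \<in> V \<and> q \<in> V \<and> adj T (fst p) (fst q) \<and> adj T' (snd p) (snd q))\<rparr>)"

(* For each s the layered tree is countable and unique up to layer-preserving isomorphism,
   so DL(2,2) is determined up to isomorphism and trees on nat suffice. *)
definition isomorphic_to_DL22 :: "'a graph \<Rightarrow> bool" where
  "isomorphic_to_DL22 H \<longleftrightarrow>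
     (\<exists>(T :: nat graph) l (T' :: nat graph) l'.
        layered_tree 1 T l \<and> layered_tree (-1) T' l' \<and>
        isomorphic_graphs H (DL_graph T l T' l'))"

end

(* Let T be the 3-regular tree with a distinguished end, parent map p and layer function l,
   and let the vertices be the pairs (x, x') with l x + l x' even, the second coordinate being
   read in the tree upside down. Pairs with l x + l x' = 2 k form a Diestel-Leader graph; join
   them by its edges, and join every v = (x, x') to P v = (p x, p x') and to P (P v). The latter
   edges are there only to make P visible in the graph: counting triangles recovers P, so all
   automorphisms commute with P. As P is four-to-one and the automorphisms are transitive,
   passing from P v to v multiplies the weight ratio by 4. A Diestel-Leader edge is reversed by
   an automorphism that exchanges the two trees, so it does not change the weight. The cocycle
   identity for |S_x y| / |S_y x| then shows that the levels are the Diestel-Leader graphs. *)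

theory Submission
  imports Defs "HOL-Library.Nat_Bijection"
begin

section \<open>Stabilizer orbits\<close>

lemma Aut_permutes: "g \<in> Aut G \<Longrightarrow> g permutes verts G"
  by (simp add: Aut_def)

text \<open>Off the vertex set both sides are false, because \<open>g\<close> sends non-vertices to
  non-vertices. Adjacency can thus be rewritten without side conditions, even under quantifiers over
  the whole type.\<close>

lemma Aut_adj_iff:
  assumes "simple_graph G" "g \<in> Aut G"
  shows "adj G (g x) (g y) \<longleftrightarrow> adj G x y"
proof (cases "x \<in> verts G \<and> y \<in> verts G")
  case True
  then show ?thesis using assms(2) by (simp add: Aut_def)
next
  case False
  then have "\<not> (g x \<in> verts G \<and> g y \<in> verts G)"
    using permutes_in_image[OF Aut_permutes[OF assms(2)]] by simp
  with False show ?thesis using assms(1) unfolding simple_graph_def by blast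
qed

lemma id_Aut: "id \<in> Aut G"
  by (simp add: Aut_def permutes_id)

lemma Aut_comp: "g \<in> Aut G \<Longrightarrow> g' \<in> Aut G \<Longrightarrow> g \<circ> g' \<in> Aut G"
  unfolding Aut_def by (auto intro: permutes_compose simp: permutes_in_image)

lemma Aut_inv:
  assumes "g \<in> Aut G"
  shows "inv g \<in> Aut G"
proof -
  have g: "g permutes verts G" using assms by (rule Aut_permutes)
  note i = permutes_inv[OF g]
  have "adj G (inv g x) (inv g y) \<longleftrightarrow> adj G x y" if "x \<in> verts G" "y \<in> verts G" for x y
  proof -
    have "inv g x \<in> verts G" "inv g y \<in> verts G"
      using that permutes_in_image[OF i] by auto
    then have "adj G (g (inv g x)) (g (inv g y)) \<longleftrightarrow> adj G (inv g x) (inv g y)"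
      using assms by (simp add: Aut_def)
    then show ?thesis by (simp add: permutes_inverses[OF g])
  qed
  with i show ?thesis by (simp add: Aut_def)
qed

lemma stab_orbit_self: "y \<in> stab_orbit G x y"
  unfolding stab_orbit_def stabilizer_def
  by (rule image_eqI[of _ _ id]) (auto simp: id_Aut)

text \<open>Automorphisms fixing \<open>x\<close> preserve the length of walks from
  \<open>x\<close>, so the orbit lies among the endpoints of walks of one fixed length; local
  finiteness leaves finitely many.\<close>

lemma finite_stab_orbit:
  assumes s: "simple_graph G" and lf: "locally_finite_graph G" and c: "connected_graph G"
    and x: "x \<in> verts G" and y: "y \<in> verts G"
  shows "finite (stab_orbit G x y)"
proof -
  have fin: "finite {w. (adj G ^^ n) x w}" for n
  proof (induction n)
    case 0
    then show ?case by simp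
  next
    case (Suc n)
    have "{w. (adj G ^^ Suc n) x w} \<subseteq> (\<Union>v\<in>{v. (adj G ^^ n) x v}. {w. adj G v w})"
      by auto
    moreover have "finite {w. adj G v w}" for v
    proof (cases "v \<in> verts G")
      case True
      then show ?thesis using lf by (simp add: locally_finite_graph_def)
    next
      case False
      then have "{w. adj G v w} = {}" using s by (auto simp: simple_graph_def)
      then show ?thesis by simp
    qed
    ultimately show ?case using Suc finite_subset by blast
  qed
  have img: "(adj G ^^ n) (g a) (g b)" if "(adj G ^^ n) a b" "g \<in> Aut G" for n g a b
    using that(1)
  proof (induction n arbitrary: b)
    case 0
    then show ?case by simp
  next
    case (Suc n)
    then obtain v where "(adj G ^^ n) a v" "adj G v b" by auto
    then show ?case using Suc.IH[of v] Aut_adj_iff[OF s that(2)] by auto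
  qed
  obtain n where "(adj G ^^ n) x y"
    using c x y unfolding connected_graph_def by (meson rtranclp_imp_relpowp)
  then have "stab_orbit G x y \<subseteq> {w. (adj G ^^ n) x w}"
    using img unfolding stab_orbit_def stabilizer_def by fastforce
  then show ?thesis using fin finite_subset by blast
qed

lemma card_stab_orbit_pos:
  assumes "simple_graph G" "locally_finite_graph G" "connected_graph G"
    and "x \<in> verts G" "y \<in> verts G"
  shows "card (stab_orbit G x y) > 0"
  using finite_stab_orbit[OF assms] stab_orbit_self[of y G x] card_gt_0_iff by blast

text \<open>An orbit-stabilizer count: the orbit of \<open>(y, z)\<close> projects onto that of
  \<open>y\<close>, and every fibre is a translate of the orbit of \<open>z\<close> under the
  stabilizer of \<open>y\<close>.\<close>

lemma card_pair_orbit: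
  assumes fin: "finite ((\<lambda>g. g y) ` H)" "finite ((\<lambda>g. g z) ` H)"
    and comp: "\<And>g g'. g \<in> H \<Longrightarrow> g' \<in> H \<Longrightarrow> g \<circ> g' \<in> H"
    and inv: "\<And>g. g \<in> H \<Longrightarrow> inv g \<in> H" and bij: "\<And>g. g \<in> H \<Longrightarrow> bij g"
  shows "card ((\<lambda>g. (g y, g z)) ` H) =
         card ((\<lambda>g. g y) ` H) * card ((\<lambda>g. g z) ` {g \<in> H. g y = y})"
proof -
  let ?A = "(\<lambda>g. (g y, g z)) ` H" and ?Z = "(\<lambda>g. g z) ` {g \<in> H. g y = y}"
  have finA: "finite ?A"
    by (rule finite_subset[OF _ finite_cartesian_product[OF fin]]) auto
  have fstA: "fst ` ?A = (\<lambda>g. g y) ` H" by force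
  have fibre: "card {a \<in> ?A. fst a = b} = card ?Z" if "b \<in> fst ` ?A" for b
  proof -
    from that obtain s where s: "s \<in> H" "b = s y" by auto
    have b: "bij s" using bij s by simp
    have "{a \<in> ?A. fst a = b} = (\<lambda>w. (b, s w)) ` ?Z"
    proof (intro equalityI subsetI)
      fix a assume "a \<in> {a \<in> ?A. fst a = b}"
      then obtain g where g: "g \<in> H" "a = (g y, g z)" "g y = s y" using s by auto
      \<comment> \<open>\<open>g\<close> and \<open>s\<close> agree at \<open>y\<close>, so this
        element of \<open>H\<close> fixes \<open>y\<close>.\<close>
      let ?t = "inv s \<circ> g"
      have "?t \<in> H" "?t y = y" "s (?t z) = g z"
        using g s b comp inv by (auto simp: bij_is_inj bij_is_surj surj_f_inv_f)
      then have "?t z \<in> ?Z" "a = (b, s (?t z))" using g s by (blast, simp)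
      then show "a \<in> (\<lambda>w. (b, s w)) ` ?Z" by blast
    next
      fix a assume "a \<in> (\<lambda>w. (b, s w)) ` ?Z"
      then obtain g where "g \<in> H" "g y = y" "a = (b, s (g z))" by auto
      then have "s \<circ> g \<in> H" "a = ((s \<circ> g) y, (s \<circ> g) z)" "fst a = b"
        using comp s by auto
      then show "a \<in> {a \<in> ?A. fst a = b}" by blast
    qed
    moreover have "inj_on (\<lambda>w. (b, s w)) ?Z"
      using b by (auto simp: inj_on_def bij_def)
    ultimately show ?thesis by (simp add: card_image)
  qed
  have "card ?A = (\<Sum>b\<in>fst ` ?A. card {a \<in> ?A. fst a = b})"
    using sum.image_gen[OF finA, of "\<lambda>_. 1::nat" fst] by simp
  also have "\<dots> = card (fst ` ?A) * card ?Z" using fibre by simp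
  finally show ?thesis using fstA by simp
qed

text \<open>Counting the orbit of \<open>(y, z)\<close> under the stabilizer of \<open>x\<close> in
  either order relates two of the six numbers. Doing so at all three vertices and multiplying gives
  the identity.\<close>

lemma stab_orbit_cocycle:
  assumes G: "simple_graph G" "locally_finite_graph G" "connected_graph G"
    and V: "x \<in> verts G" "y \<in> verts G" "z \<in> verts G"
  shows "card (stab_orbit G x y) * card (stab_orbit G y z) * card (stab_orbit G z x) =
         card (stab_orbit G y x) * card (stab_orbit G z y) * card (stab_orbit G x z)"
proof -
  define t where "t a b c = card ((\<lambda>g. g c) ` {g \<in> stabilizer G a. g b = b})" for a b c
  have pair: "card ((\<lambda>g. (g b, g c)) ` stabilizer G a) = card (stab_orbit G a b) * t a b c"
    if "a \<in> verts G" "b \<in> verts G" "c \<in> verts G" for a b c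
    unfolding stab_orbit_def t_def
  proof (rule card_pair_orbit)
    show "finite ((\<lambda>g. g b) ` stabilizer G a)" "finite ((\<lambda>g. g c) ` stabilizer G a)"
      using finite_stab_orbit[OF G] that unfolding stab_orbit_def by auto
    show "bij g" if "g \<in> stabilizer G a" for g
      using that Aut_permutes permutes_bij unfolding stabilizer_def by blast
    then show "inv g \<in> stabilizer G a" if "g \<in> stabilizer G a" for g
      using that Aut_inv unfolding stabilizer_def by (auto simp: bij_is_inj inv_f_eq)
  qed (auto simp: stabilizer_def intro: Aut_comp)
  have swap: "card (stab_orbit G a b) * t a b c = card (stab_orbit G a c) * t a c b"
    if "a \<in> verts G" "b \<in> verts G" "c \<in> verts G" for a b c
  proof -
    have "(\<lambda>g. (g c, g b)) ` stabilizer G a = prod.swap ` (\<lambda>g. (g b, g c)) ` stabilizer G a"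
      by (auto simp: image_image)
    then have "card ((\<lambda>g. (g c, g b)) ` stabilizer G a) = card ((\<lambda>g. (g b, g c)) ` stabilizer G a)"
      by (simp add: card_image)
    then show ?thesis using pair[OF that] pair[OF that(1,3,2)] by simp
  qed
  have sym: "t a b c = t b a c" for a b c
    unfolding t_def stabilizer_def by (rule arg_cong[of _ _ card]) auto
  have pos: "t a b c > 0" if "a \<in> verts G" "b \<in> verts G" "c \<in> verts G" for a b c
  proof -
    have "finite ((\<lambda>g. g c) ` {g \<in> stabilizer G a. g b = b})"
      by (rule finite_subset[OF _ finite_stab_orbit[OF G that(1,3)]]) (auto simp: stab_orbit_def)
    moreover have "id \<in> {g \<in> stabilizer G a. g b = b}" by (simp add: stabilizer_def id_Aut)
    ultimately show ?thesis unfolding t_def card_gt_0_iff by blast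
  qed
  \<comment> \<open>Orbit sizes of one vertex under the common stabilizer of the other two. By
    \<open>sym\<close> there are only three of them, and each occurs once on either side of the
    product.\<close>
  define p where "p = t x y z" define q where "q = t y z x" define r where "r = t x z y"
  have "card (stab_orbit G x y) * p = card (stab_orbit G x z) * r"
    "card (stab_orbit G y z) * q = card (stab_orbit G y x) * p"
    "card (stab_orbit G z x) * r = card (stab_orbit G z y) * q"
    using swap[of x y z] swap[of y z x] swap[of z x y] V sym[of y x z] sym[of z x y] sym[of z y x]
    by (simp_all add: p_def q_def r_def)
  then have "(card (stab_orbit G x y) * p) * (card (stab_orbit G y z) * q) * (card (stab_orbit G z x) * r)
    = (card (stab_orbit G x z) * r) * (card (stab_orbit G y x) * p) * (card (stab_orbit G z y) * q)"
    by simp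
  then have "(card (stab_orbit G x y) * card (stab_orbit G y z) * card (stab_orbit G z x)) * (p * q * r)
    = (card (stab_orbit G y x) * card (stab_orbit G z y) * card (stab_orbit G x z)) * (p * q * r)"
    by (simp add: ac_simps)
  moreover have "p * q * r > 0" using pos V by (simp add: p_def q_def r_def)
  ultimately show ?thesis by simp
qed

text \<open>Conjugation by \<open>g\<close> exchanges the two stabilizers, so \<open>g\<close> maps
  one orbit bijectively onto the other.\<close>

lemma card_stab_orbit_flip:
  assumes g: "g \<in> Aut G" "g x = y" "g y = x"
  shows "card (stab_orbit G x y) = card (stab_orbit G y x)"
proof -
  have b: "bij g" using Aut_permutes[OF g(1)] by (rule permutes_bij)
  have iy: "inv g y = x" and ix: "inv g x = y"
    using g b by (auto simp: bij_is_inj inv_f_eq)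
  have "stab_orbit G y x = g ` stab_orbit G x y"
  proof (intro equalityI subsetI)
    fix w assume "w \<in> stab_orbit G y x"
    then obtain s where s: "s \<in> Aut G" "s y = y" "w = s x"
      by (auto simp: stab_orbit_def stabilizer_def)
    let ?s = "inv g \<circ> s \<circ> g"
    have "?s \<in> stabilizer G x"
      using s g iy by (simp add: stabilizer_def Aut_comp Aut_inv)
    then have "?s y \<in> stab_orbit G x y" unfolding stab_orbit_def by (rule imageI)
    moreover have "w = g (?s y)" using s g b by (simp add: bij_is_surj surj_f_inv_f)
    ultimately show "w \<in> g ` stab_orbit G x y" by blast
  next
    fix w assume "w \<in> g ` stab_orbit G x y"
    then obtain s where s: "s \<in> Aut G" "s x = x" "w = g (s y)"
      by (auto simp: stab_orbit_def stabilizer_def)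
    let ?s = "g \<circ> s \<circ> inv g"
    have "?s \<in> stabilizer G y"
      using s g iy by (simp add: stabilizer_def Aut_comp Aut_inv)
    moreover have "w = ?s x" using s ix by simp
    ultimately show "w \<in> stab_orbit G y x" unfolding stab_orbit_def by blast
  qed
  moreover have "inj_on g (stab_orbit G x y)" using b by (meson bij_is_inj inj_on_subset subset_UNIV)
  ultimately show ?thesis by (simp add: card_image)
qed

section \<open>Stacking graphs along a four-to-one map\<close>

text \<open>\<open>D\<close> holds the horizontal edges and \<open>h\<close> is the level. The
  parity of \<open>f\<close> alternates along \<open>D\<close> while \<open>P\<close> keeps
  \<open>f\<close>; this is what excludes triangles through horizontal edges. The maps in
  \<open>homogeneous\<close> and \<open>flip\<close> commute with \<open>P\<close>, so they give
  automorphisms of the stacked graph.\<close>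

locale fibred_graph =
  fixes V :: "'v set" and D :: "'v \<Rightarrow> 'v \<Rightarrow> bool" and P :: "'v \<Rightarrow> 'v" and h f :: "'v \<Rightarrow> int"
  assumes V_nonempty: "V \<noteq> {}"
    and D_V: "D u v \<Longrightarrow> u \<in> V \<and> v \<in> V"
    and D_sym: "D u v \<Longrightarrow> D v u"
    and D_h: "D u v \<Longrightarrow> h u = h v"
    and D_f: "D u v \<Longrightarrow> odd (f u - f v)"
    and D_finite: "finite {v. D u v}"
    and D_connected: "\<lbrakk>u \<in> V; v \<in> V; h u = h v\<rbrakk> \<Longrightarrow> D\<^sup>*\<^sup>* u v"
    and P_V: "u \<in> V \<Longrightarrow> P u \<in> V"
    and P_h: "u \<in> V \<Longrightarrow> h (P u) = h u - 1"
    and P_f: "u \<in> V \<Longrightarrow> f (P u) = f u"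
    and P_fibre: "v \<in> V \<Longrightarrow> card {u \<in> V. P u = v} = 4"
    and homogeneous: "\<lbrakk>u \<in> V; v \<in> V\<rbrakk> \<Longrightarrow>
      \<exists>g. bij_betw g V V \<and> (\<forall>a\<in>V. g (P a) = P (g a)) \<and>
          (\<forall>a\<in>V. \<forall>b\<in>V. D (g a) (g b) \<longleftrightarrow> D a b) \<and> g u = v"
    and flip: "D u v \<Longrightarrow>
      \<exists>g. bij_betw g V V \<and> (\<forall>a\<in>V. g (P a) = P (g a)) \<and>
          (\<forall>a\<in>V. \<forall>b\<in>V. D (g a) (g b) \<longleftrightarrow> D a b) \<and> g u = v \<and> g v = u"
begin

section \<open>The stacked graph and its elementary properties\<close>

definition up :: "'v \<Rightarrow> 'v \<Rightarrow> bool" where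
  "up u v \<longleftrightarrow> u \<in> V \<and> v \<in> V \<and> (v = P u \<or> v = P (P u))"

definition stack :: "'v graph" where
  "stack = \<lparr>verts = V, adj = (\<lambda>u v. D u v \<or> up u v \<or> up v u)\<rparr>"

abbreviation E where "E \<equiv> adj stack"

lemma verts_stack [simp]: "verts stack = V"
  by (simp add: stack_def)

lemma E_iff: "E u v \<longleftrightarrow> D u v \<or> up u v \<or> up v u"
  by (simp add: stack_def)

lemma E_sym: "E u v \<Longrightarrow> E v u"
  using D_sym by (auto simp: E_iff)

lemma E_V: "E u v \<Longrightarrow> u \<in> V \<and> v \<in> V"
  using D_V by (auto simp: E_iff up_def)

lemma PP_h: "u \<in> V \<Longrightarrow> h (P (P u)) = h u - 2"
  using P_h P_V by simp

lemma PP_f: "u \<in> V \<Longrightarrow> f (P (P u)) = f u"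
  using P_f P_V by simp

lemma up_h: "up u v \<Longrightarrow> h v = h u - 1 \<or> h v = h u - 2"
  using P_h PP_h by (auto simp: up_def)

lemma E_range: "E u v \<Longrightarrow> \<bar>h v - h u\<bar> \<le> 2"
  using D_h up_h unfolding E_iff by fastforce

lemma E_level: "E u v \<Longrightarrow> h v = h u \<Longrightarrow> D u v"
  using up_h unfolding E_iff by fastforce

lemma E_f_level: "E u v \<Longrightarrow> h v = h u \<Longrightarrow> odd (f u - f v)"
  using E_level D_f by blast

lemma E_f_across:
  assumes "E u v" "h v \<noteq> h u"
  shows "f v = f u"
proof -
  have "\<not> D u v" using D_h[of u v] assms(2) by metis
  then have "up u v \<or> up v u" using assms(1) by (simp add: E_iff)
  then show ?thesis using P_f PP_f unfolding up_def by metis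
qed

text \<open>The change of \<open>h\<close> reveals the kind of edge: \<open>D\<close> keeps
  \<open>h\<close>, one application of \<open>P\<close> lowers it by 1 and two lower it by
  2.\<close>

lemma E_step:
  assumes "E u v"
  shows "h v = h u - 1 \<Longrightarrow> v = P u" "h v = h u + 1 \<Longrightarrow> P v = u" "h v = h u - 2 \<Longrightarrow> v = P (P u)"
proof -
  consider "h u = h v" | "v = P u" "h v = h u - 1" | "v = P (P u)" "h v = h u - 2"
    | "u = P v" "h u = h v - 1" | "u = P (P v)" "h u = h v - 2"
    using assms D_h P_h PP_h unfolding E_iff up_def by metis
  note cases = this
  show "h v = h u - 1 \<Longrightarrow> v = P u" by (cases rule: cases; (assumption | erule sym | linarith))
  show "h v = h u + 1 \<Longrightarrow> P v = u" by (cases rule: cases; (assumption | erule sym | linarith))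
  show "h v = h u - 2 \<Longrightarrow> v = P (P u)" by (cases rule: cases; (assumption | erule sym | linarith))
qed

lemma E_P: "u \<in> V \<Longrightarrow> E u (P u)" and E_PP: "u \<in> V \<Longrightarrow> E u (P (P u))"
  using P_V by (auto simp: E_iff up_def)

lemma simple_stack: "simple_graph stack"
proof -
  have "x \<noteq> y" if "E x y" for x y
    using E_level[OF that] D_f[of x y] by auto
  then show ?thesis using E_V E_sym by (auto simp: simple_graph_def)
qed

lemma finite_fibre: "v \<in> V \<Longrightarrow> finite {u \<in> V. P u = v}"
  by (rule card_ge_0_finite) (simp add: P_fibre)

lemma locally_finite_stack: "locally_finite_graph stack"
proof -
  have "finite {v. E u v}" if u: "u \<in> V" for u
  proof -
    have "{v. E u v} \<subseteq> {v. D u v} \<union> {P u, P (P u)} \<union> {v \<in> V. P v = u}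
      \<union> (\<Union>w\<in>{w \<in> V. P w = u}. {v \<in> V. P v = w})"
      using P_V by (auto simp: E_iff up_def)
    moreover have "finite \<dots>" using D_finite finite_fibre u by auto
    ultimately show ?thesis by (rule finite_subset)
  qed
  then show ?thesis by (simp add: locally_finite_graph_def)
qed

lemma funpow_P: "u \<in> V \<Longrightarrow> (P ^^ n) u \<in> V \<and> h ((P ^^ n) u) = h u - int n"
  by (induction n) (auto simp: P_V P_h)

lemma infinite_V: "infinite V"
proof -
  obtain u where u: "u \<in> V" using V_nonempty by blast
  have "inj (\<lambda>n. (P ^^ n) u)"
  proof (rule injI)
    fix m n assume "(P ^^ m) u = (P ^^ n) u"
    then have "h ((P ^^ m) u) = h ((P ^^ n) u)" by simp
    then show "m = n" using funpow_P[OF u, of m] funpow_P[OF u, of n] by linarith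
  qed
  then have "infinite (range (\<lambda>n. (P ^^ n) u))" by (simp add: finite_image_iff)
  moreover have "range (\<lambda>n. (P ^^ n) u) \<subseteq> V" using funpow_P[OF u] by auto
  ultimately show ?thesis using finite_subset by blast
qed

lemma E_connected:
  assumes "u \<in> V" "v \<in> V"
  shows "E\<^sup>*\<^sup>* u v"
proof -
  have sym: "E\<^sup>*\<^sup>* b a" if "E\<^sup>*\<^sup>* a b" for a b
    using that E_sym by (induction rule: rtranclp_induct) (auto intro: converse_rtranclp_into_rtranclp)
  have climb: "E\<^sup>*\<^sup>* a ((P ^^ n) a)" if "a \<in> V" for a n
  proof (induction n)
    case (Suc n)
    then show ?case using E_P funpow_P[OF that, of n] by (auto intro: rtranclp.rtrancl_into_rtrancl)
  qed simp
  \<comment> \<open>Truncation by \<open>nat\<close> lets only the vertex with the larger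
    \<open>h\<close> move; the other exponent is 0.\<close>
  define m n where "m = nat (h u - h v)" and "n = nat (h v - h u)"
  have "D\<^sup>*\<^sup>* ((P ^^ m) u) ((P ^^ n) v)"
    by (rule D_connected) (use funpow_P assms in \<open>auto simp: m_def n_def\<close>)
  then have "E\<^sup>*\<^sup>* ((P ^^ m) u) ((P ^^ n) v)"
    by (rule mono_rtranclp[rule_format, rotated]) (simp add: E_iff)
  with climb[OF assms(1), of m] sym[OF climb[OF assms(2), of n]] show ?thesis
    by (meson rtranclp_trans)
qed

lemma connected_stack: "connected_graph stack"
  using E_connected V_nonempty by (simp add: connected_graph_def)

lemma restrict_in_Aut:
  assumes "bij_betw g V V" "\<forall>a\<in>V. g (P a) = P (g a)"
    and "\<forall>a\<in>V. \<forall>b\<in>V. D (g a) (g b) \<longleftrightarrow> D a b"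
  shows "(\<lambda>v. if v \<in> V then g v else v) \<in> Aut stack"
proof -
  let ?g = "\<lambda>v. if v \<in> V then g v else v"
  have gV: "g a \<in> V" if "a \<in> V" for a using assms(1) that bij_betwE by blast
  have inj: "g a = g b \<longleftrightarrow> a = b" if "a \<in> V" "b \<in> V" for a b
    using assms(1) that by (auto simp: bij_betw_def inj_on_def)
  have "bij_betw ?g V V" using assms(1) by (simp cong: bij_betw_cong)
  then have "?g permutes V" by (rule bij_imp_permutes) simp
  moreover have "E (g a) (g b) \<longleftrightarrow> E a b" if "a \<in> V" "b \<in> V" for a b
  proof -
    have "up (g a) (g b) \<longleftrightarrow> up a b" if "a \<in> V" "b \<in> V" for a b
    proof -
      have "P (g a) = g (P a)" "P (P (g a)) = g (P (P a))" using assms(2) that P_V by auto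
      then show ?thesis using that inj P_V gV by (auto simp: up_def)
    qed
    then show ?thesis using that assms(3) by (simp add: E_iff)
  qed
  ultimately show ?thesis by (simp add: Aut_def)
qed

lemma transitive_stack: "transitive_graph stack"
proof -
  have "\<exists>g\<in>Aut stack. g u = v" if uv: "u \<in> V" "v \<in> V" for u v
  proof -
    obtain g where g: "bij_betw g V V" "\<forall>a\<in>V. g (P a) = P (g a)"
      "\<forall>a\<in>V. \<forall>b\<in>V. D (g a) (g b) \<longleftrightarrow> D a b" "g u = v"
      using homogeneous[OF uv] by blast
    show ?thesis by (rule bexI[OF _ restrict_in_Aut[OF g(1-3)]]) (use uv g in auto)
  qed
  then show ?thesis
    using simple_stack locally_finite_stack connected_stack infinite_V
    by (simp add: transitive_graph_def)
qed

subsection \<open>Recovering the map from the graph\<close>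

text \<open>For adjacent \<open>u\<close> and \<open>v\<close> this says that their edge lies in
  exactly one triangle, which singles out the edges between a vertex and its image under
  \<open>P\<close> applied twice.\<close>

definition lone :: "'v \<Rightarrow> 'v \<Rightarrow> bool" where
  "lone u v \<longleftrightarrow> (\<exists>!w. E u w \<and> E v w)"

text \<open>A common neighbour on the same level would close an odd cycle against the parity of
  \<open>f\<close>; one on another level would share its \<open>f\<close> with both ends, whose
  parities differ.\<close>

lemma no_common_D:
  assumes "D u v" "E u w" "E v w"
  shows False
proof (cases "h w = h u")
  case True
  then have "odd (f u - f w)" "odd (f v - f w)"
    using assms E_f_level D_h[OF assms(1)] by simp_all
  then have "even ((f u - f w) - (f v - f w))" by simp
  then show False using D_f[OF assms(1)] by simp
next
  case False
  then have "f w = f u" "f w = f v"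
    using E_f_across[OF assms(2)] E_f_across[OF assms(3)] D_h[OF assms(1)] by simp_all
  then show False using D_f[OF assms(1)] by simp
qed

text \<open>If \<open>w\<close> were level with \<open>u\<close>, the edge from \<open>u\<close>
  would change the parity of \<open>f\<close>, while the edge from \<open>v\<close> would cross
  levels and keep \<open>f\<close>.\<close>

lemma common_across:
  assumes "E u w" "E v w" "f u = f v" "h u \<noteq> h v"
  shows "h w \<noteq> h u"
proof
  assume h: "h w = h u"
  then have "odd (f u - f w)" by (rule E_f_level[OF assms(1)])
  moreover have "f w = f v" by (rule E_f_across[OF assms(2)]) (use h assms(4) in simp)
  ultimately show False using assms(3) by simp
qed

text \<open>A common neighbour avoids both end levels, and edges span at most two levels, so only
  the middle level remains.\<close>

lemma common_PP:
  assumes "u \<in> V" "E u w" "E (P (P u)) w"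
  shows "w = P u"
proof -
  note f = PP_f[OF assms(1)] and h = PP_h[OF assms(1)]
  have "h w \<noteq> h u" "h w \<noteq> h (P (P u))"
    using common_across[OF assms(2,3)] common_across[OF assms(3,2)] f h by simp_all
  then have "h w = h u - 1" using E_range[OF assms(2)] E_range[OF assms(3)] h by linarith
  then show ?thesis by (rule E_step(1)[OF assms(2)])
qed

lemma lone_PP: "u \<in> V \<Longrightarrow> lone (P (P u)) u"
  unfolding lone_def
  by (rule ex1I[of _ "P u"]) (simp_all add: common_PP E_P P_V E_sym)

text \<open>The same count now leaves one level below both ends and one above both;
  \<open>E_step\<close> identifies the vertices there.\<close>

lemma common_P:
  assumes "u \<in> V" "E u w" "E (P u) w"
  shows "w = P (P u) \<or> w \<in> V \<and> P w = u"
proof -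
  note f = P_f[OF assms(1)] and h = P_h[OF assms(1)]
  have "h w \<noteq> h u" "h w \<noteq> h (P u)"
    using common_across[OF assms(2,3)] common_across[OF assms(3,2)] f h by simp_all
  then have "h w = h u - 2 \<or> h w = h u + 1"
    using E_range[OF assms(2)] E_range[OF assms(3)] h by linarith
  then show ?thesis using E_step[OF assms(2)] E_V[OF assms(2)] by blast
qed

lemma two_children:
  assumes "u \<in> V"
  obtains w w' where "w \<in> V" "w' \<in> V" "w \<noteq> w'" "P w = u" "P w' = u"
proof -
  have "{x \<in> V. P x = u} \<noteq> {}" using P_fibre[OF assms] by (metis card.empty zero_neq_numeral)
  then obtain w where w: "w \<in> V" "P w = u" by blast
  have "{x \<in> V. P x = u} \<noteq> {w}" using P_fibre[OF assms] by auto
  with w obtain w' where "w' \<in> V" "P w' = u" "w' \<noteq> w" by blast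
  with w show ?thesis using that by blast
qed

text \<open>Each child \<open>w\<close> of \<open>u\<close> is a common neighbour: \<open>u\<close>
  is \<open>P w\<close> and \<open>P u\<close> is \<open>P (P w)\<close>.\<close>

lemma not_lone_P:
  assumes "u \<in> V"
  shows "\<not> lone u (P u)"
proof -
  obtain w w' where w: "w \<in> V" "w' \<in> V" "w \<noteq> w'" "P w = u" "P w' = u"
    using two_children[OF assms] by blast
  then have "E u w" "E (P u) w" "E u w'" "E (P u) w'"
    using E_P[of w] E_PP[of w] E_P[of w'] E_PP[of w'] E_sym by simp_all
  with w(3) show ?thesis unfolding lone_def by blast
qed

text \<open>An edge from \<open>u\<close> to \<open>P u\<close> lies in five triangles, one above it and four below it;
  an edge from \<open>u\<close> to \<open>P (P u)\<close> lies in one triangle, and a \<open>D\<close>-edge in none.\<close>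

lemma P_characterization:
  assumes "u \<in> V"
  shows "v = P u \<longleftrightarrow> E u v \<and> (\<exists>w w'. w \<noteq> w' \<and> E u w \<and> E v w \<and> E u w' \<and> E v w' \<and>
           lone v w \<and> lone v w')"
proof
  assume v: "v = P u"
  \<comment> \<open>Children of \<open>u\<close> serve as witnesses: for them \<open>P u\<close> is
    \<open>P (P w)\<close>, so \<open>lone_PP\<close> applies.\<close>
  obtain w w' where w: "w \<in> V" "w' \<in> V" "w \<noteq> w'" "P w = u" "P w' = u"
    using two_children[OF assms] by blast
  then have "E u w" "E v w" "E u w'" "E v w'" "lone v w" "lone v w'"
    using E_P[of w] E_PP[of w] E_P[of w'] E_PP[of w'] lone_PP[of w] lone_PP[of w'] E_sym v by simp_all
  with w(3) E_P[OF assms] v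
  show "E u v \<and> (\<exists>w w'. w \<noteq> w' \<and> E u w \<and> E v w \<and> E u w' \<and> E v w' \<and> lone v w \<and> lone v w')"
    by blast
next
  assume "E u v \<and> (\<exists>w w'. w \<noteq> w' \<and> E u w \<and> E v w \<and> E u w' \<and> E v w' \<and> lone v w \<and> lone v w')"
  then obtain w w' where w: "w \<noteq> w'" "E u v" "E u w" "E v w" "E u w'" "E v w'"
    "lone v w" "lone v w'" by blast
  have V: "u \<in> V" "v \<in> V" using w(2) E_V by auto
  \<comment> \<open>If the edge ran the other way, the third vertex of a triangle would be
    \<open>P u\<close> or a child of \<open>v\<close>. The edge from \<open>v\<close> to a child is
    not lone, so two different witnesses could not exist.\<close>
  have "x = P u" if "u = P v" "E u x" "E v x" "lone v x" for x
  proof -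
    have "\<not> (x \<in> V \<and> P x = v)" using not_lone_P[of x] that(4) unfolding lone_def by metis
    then show ?thesis using common_P[OF V(2), of x] that by blast
  qed
  then have "u \<noteq> P v" using w by metis
  moreover have "\<not> D u v" using no_common_D w by blast
  moreover have "v \<noteq> P (P u)" "u \<noteq> P (P v)" using common_PP w V by metis+
  ultimately show "v = P u" using w(2) by (auto simp: E_iff up_def)
qed

text \<open>The description in \<open>P_characterization\<close> speaks of adjacency alone, so an
  automorphism carries it from \<open>u\<close> and \<open>P u\<close> to their images.\<close>

lemma Aut_P:
  assumes g: "g \<in> Aut stack" and u: "u \<in> V"
  shows "g (P u) = P (g u)"
proof -
  note E = Aut_adj_iff[OF simple_stack g]
  have p: "g permutes V" using Aut_permutes[OF g] by simp
  then have inj: "g a = g b \<longleftrightarrow> a = b" for a b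
    using permutes_inj by (metis injD)
  have onto: "\<exists>a. w = g a" for w using permutes_surj[OF p] by (metis surjD)
  \<comment> \<open>The quantifier in \<open>lone\<close> ranges over the whole type; it can be
    reindexed because \<open>g\<close> is a bijection there.\<close>
  have ex1: "(\<exists>!w. Q w) \<longleftrightarrow> (\<exists>!w. Q (g w))" for Q
  proof
    assume "\<exists>!w. Q w"
    then obtain w where w: "Q w" "\<And>w'. Q w' \<Longrightarrow> w' = w" by blast
    obtain a where "w = g a" using onto by blast
    with w inj show "\<exists>!w. Q (g w)" by (intro ex1I[of _ a]) blast+
  next
    assume "\<exists>!w. Q (g w)"
    then obtain a where a: "Q (g a)" "\<And>b. Q (g b) \<Longrightarrow> b = a" by blast
    have "w = g a" if "Q w" for w using onto[of w] a(2) that by blast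
    with a(1) show "\<exists>!w. Q w" by blast
  qed
  have lone: "lone (g a) (g b) \<longleftrightarrow> lone a b" for a b
    unfolding lone_def by (subst ex1) (simp only: E)
  have gu: "g u \<in> V" using p u permutes_in_image by metis
  have "E u (P u) \<and> (\<exists>w w'. w \<noteq> w' \<and> E u w \<and> E (P u) w \<and> E u w' \<and> E (P u) w' \<and>
           lone (P u) w \<and> lone (P u) w')"
    using P_characterization[OF u] by blast
  then obtain w w' where "w \<noteq> w'" "E u (P u)" "E u w" "E (P u) w" "E u w'" "E (P u) w'"
    "lone (P u) w" "lone (P u) w'" by blast
  then have "g w \<noteq> g w'" "E (g u) (g (P u))" "E (g u) (g w)" "E (g (P u)) (g w)"
    "E (g u) (g w')" "E (g (P u)) (g w')" "lone (g (P u)) (g w)" "lone (g (P u)) (g w')"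
    by (simp_all add: E lone inj)
  then show ?thesis using P_characterization[OF gu] by blast
qed

subsection \<open>Weights and levels\<close>

abbreviation S where "S u v \<equiv> real (card (stab_orbit stack u v))"

lemma S_pos: "u \<in> V \<Longrightarrow> v \<in> V \<Longrightarrow> S u v > 0"
  using card_stab_orbit_pos[OF simple_stack locally_finite_stack connected_stack] by simp

text \<open>Automorphisms commute with \<open>P\<close>, so fixing \<open>u\<close> fixes
  \<open>P u\<close>. Conversely, an automorphism taking \<open>u\<close> to another point of its
  fibre automatically fixes \<open>P u\<close>, so by transitivity the second orbit is the whole
  fibre.\<close>

lemma S_P:
  assumes u: "u \<in> V"
  shows "S u (P u) = 1" and "S (P u) u = 4"
proof -
  have "stab_orbit stack u (P u) = {P u}"
  proof
    show "stab_orbit stack u (P u) \<subseteq> {P u}"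
      using Aut_P[OF _ u] unfolding stab_orbit_def stabilizer_def by fastforce
  qed (use stab_orbit_self in auto)
  then show "S u (P u) = 1" by simp
  have "stab_orbit stack (P u) u = {w \<in> V. P w = P u}"
  proof (intro equalityI subsetI)
    fix w assume "w \<in> stab_orbit stack (P u) u"
    then obtain g where g: "g \<in> Aut stack" "g (P u) = P u" "w = g u"
      by (auto simp: stab_orbit_def stabilizer_def)
    have "w \<in> V" using permutes_in_image[OF Aut_permutes[OF g(1)]] g u by simp
    then show "w \<in> {w \<in> V. P w = P u}" using g Aut_P[OF g(1) u] by simp
  next
    fix w assume w: "w \<in> {w \<in> V. P w = P u}"
    then obtain g where g: "g \<in> Aut stack" "g u = w"
      using transitive_stack u by (auto simp: transitive_graph_def)
    then have "g (P u) = P u" using Aut_P[OF g(1) u] w by simp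
    then show "w \<in> stab_orbit stack (P u) u" using g by (auto simp: stab_orbit_def stabilizer_def)
  qed
  then show "S (P u) u = 4" using P_fibre[OF P_V[OF u]] by simp
qed

lemma S_D:
  assumes "D u v"
  shows "S u v = S v u"
proof -
  have V: "u \<in> V" "v \<in> V" using D_V assms by auto
  obtain g where g: "bij_betw g V V" "\<forall>a\<in>V. g (P a) = P (g a)"
      "\<forall>a\<in>V. \<forall>b\<in>V. D (g a) (g b) \<longleftrightarrow> D a b" "g u = v" "g v = u"
    using flip[OF assms] by blast
  have "card (stab_orbit stack u v) = card (stab_orbit stack v u)"
    by (rule card_stab_orbit_flip[OF restrict_in_Aut[OF g(1-3)]]) (use g V in auto)
  then show ?thesis by simp
qed

text \<open>The expected value of \<open>S u v / S v u\<close>, cleared of its denominator; the base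
  4 is the size of the fibres of \<open>P\<close>.\<close>

definition balanced :: "'v \<Rightarrow> 'v \<Rightarrow> bool" where
  "balanced u v \<longleftrightarrow> S u v = 4 powi (h v - h u) * S v u"

lemma balanced_sym: "balanced u v \<Longrightarrow> balanced v u"
proof -
  assume "balanced u v"
  then have "4 powi (h u - h v) * S u v = (4 powi (h u - h v) * 4 powi (h v - h u)) * S v u"
    by (simp add: balanced_def)
  also have "(4::real) powi (h u - h v) * 4 powi (h v - h u) = 1"
    by (simp flip: power_int_add)
  finally show ?thesis by (simp add: balanced_def)
qed

text \<open>Insert the two known ratios into the cocycle identity and cancel the positive factor
  \<open>S v u * S w v\<close>.\<close>

lemma balanced_trans:
  assumes uv: "balanced u v" and vw: "balanced v w" and V: "u \<in> V" "v \<in> V" "w \<in> V"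
  shows "balanced u w"
proof -
  have c: "S u v * S v w * S w u = S v u * S w v * S u w"
    using stab_orbit_cocycle[OF simple_stack locally_finite_stack connected_stack, of u v w] V
    by (simp flip: of_nat_mult)
  have e: "(4::real) powi (h v - h u) * 4 powi (h w - h v) = 4 powi (h w - h u)"
    by (simp flip: power_int_add)
  have "S v u * S w v * S u w = (4 powi (h v - h u) * S v u) * (4 powi (h w - h v) * S w v) * S w u"
    unfolding c[symmetric] by (simp only: uv[unfolded balanced_def] vw[unfolded balanced_def])
  also have "\<dots> = S v u * S w v * ((4 powi (h v - h u) * 4 powi (h w - h v)) * S w u)"
    by (simp only: ac_simps)
  also have "\<dots> = S v u * S w v * (4 powi (h w - h u) * S w u)" by (simp only: e)
  finally have "S v u * S w v * S u w = S v u * S w v * (4 powi (h w - h u) * S w u)" .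
  moreover have "S v u * S w v \<noteq> 0" using S_pos[OF V(2,1)] S_pos[OF V(3,2)] by simp
  ultimately show ?thesis unfolding balanced_def by (rule mult_left_cancel[THEN iffD1, rotated])
qed

lemma balanced_P: "u \<in> V \<Longrightarrow> balanced u (P u)"
  by (simp add: balanced_def S_P P_h power_int_minus)

text \<open>Horizontal edges are balanced by a flip, single steps of \<open>P\<close> by
  \<open>S_P\<close>, and double steps by composition; transitivity then extends the relation along
  walks.\<close>

lemma balanced_all:
  assumes "u \<in> V" "v \<in> V"
  shows "balanced u v"
proof -
  have up: "balanced a b" if "up a b" for a b
  proof -
    have a: "a \<in> V" "P a \<in> V" "P (P a) \<in> V" using that P_V by (simp_all add: up_def)
    then have "balanced a (P (P a))" using balanced_trans balanced_P by blast
    then show ?thesis using that balanced_P[OF a(1)] unfolding up_def by metis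
  qed
  have "balanced a b" if "D a b" for a b
    using S_D[OF that] D_h[OF that] by (simp add: balanced_def)
  then have edge: "balanced a b" if "E a b" for a b
    using that up[of a b] balanced_sym[OF up[of b a]] unfolding E_iff by blast
  show ?thesis using E_connected[OF assms]
  proof (induction rule: rtranclp_induct)
    case base
    then show ?case by (simp add: balanced_def)
  next
    case (step y z)
    then show ?case using balanced_trans[of u y z] edge assms E_V by blast
  qed
qed

lemma card_stab_orbit_eq_iff:
  assumes "u \<in> V" "v \<in> V"
  shows "card (stab_orbit stack u v) = card (stab_orbit stack v u) \<longleftrightarrow> h u = h v"
proof -
  have "card (stab_orbit stack u v) = card (stab_orbit stack v u) \<longleftrightarrow> S u v = S v u"
    by simp
  also have "\<dots> \<longleftrightarrow> 4 powi (h v - h u) * S v u = S v u"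
    using balanced_all[OF assms] by (simp only: balanced_def)
  also have "\<dots> \<longleftrightarrow> (4::real) powi (h v - h u) = 1"
    using S_pos[OF assms(2,1)] by (simp only: mult_cancel_right2) simp
  also have "\<dots> \<longleftrightarrow> h u = h v"
  proof (cases "h u" "h v" rule: linorder_cases)
    case less
    then show ?thesis using one_less_power_int[of "4::real" "h v - h u"] by simp
  next
    case greater
    then have "(4::real) powi (h v - h u) < 4 powi 0"
      by (intro power_int_strict_increasing) simp_all
    then show ?thesis using greater by simp
  qed simp
  finally show ?thesis .
qed

lemma not_unimodular_stack: "\<not> unimodular stack"
proof -
  obtain u where u: "u \<in> V" using V_nonempty by blast
  have "h u \<noteq> h (P u)" using P_h[OF u] by simp
  then have "card (stab_orbit stack u (P u)) \<noteq> card (stab_orbit stack (P u) u)"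
    by (simp add: card_stab_orbit_eq_iff[OF u P_V[OF u]])
  then show ?thesis using u P_V[OF u] unfolding unimodular_def verts_stack by blast
qed

text \<open>By \<open>card_stab_orbit_eq_iff\<close> the sets of equal weight are those on which
  \<open>h\<close> is constant, and maximality fills up the level.\<close>

lemma level_stack:
  assumes "is_level stack L"
  obtains k where "L = {v \<in> V. h v = k}" "L \<noteq> {}"
proof -
  have eq: "equal_weight_set stack M \<longleftrightarrow> M \<subseteq> V \<and> (\<forall>u\<in>M. \<forall>v\<in>M. h u = h v)" for M
    unfolding equal_weight_set_def verts_stack
    by (intro conj_cong ball_cong refl card_stab_orbit_eq_iff) auto
  have max: "M = L" if "equal_weight_set stack M" "L \<subseteq> M" for M
    using assms that by (simp add: is_level_def)
  have L: "equal_weight_set stack L" using assms by (simp add: is_level_def)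
  \<comment> \<open>The empty set has equal weights vacuously, but every singleton properly extends
    it.\<close>
  have "L \<noteq> {}"
  proof
    assume "L = {}"
    moreover obtain u where "u \<in> V" using V_nonempty by blast
    ultimately show False using max[of "{u}"] by (simp add: eq)
  qed
  then obtain u where u: "u \<in> L" by blast
  have "{v \<in> V. h v = h u} = L"
  proof (rule max)
    show "equal_weight_set stack {v \<in> V. h v = h u}" unfolding eq by auto
    show "L \<subseteq> {v \<in> V. h v = h u}" using L u unfolding eq by blast
  qed
  with \<open>L \<noteq> {}\<close> show ?thesis using that by blast
qed

text \<open>Edges within a level are horizontal, and \<open>D\<close> stays in \<open>V\<close> and
  keeps \<open>h\<close>, so restricting one endpoint to the level restricts both.\<close>

lemma induced_level_stack:
  "induced_subgraph stack {v \<in> V. h v = k} =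
   \<lparr>verts = {v \<in> V. h v = k}, adj = (\<lambda>u v. D u v \<and> h u = k)\<rparr>"
proof -
  have "(u \<in> V \<and> h u = k) \<and> (v \<in> V \<and> h v = k) \<and> E u v \<longleftrightarrow> D u v \<and> h u = k" for u v
    using D_V[of u v] D_h[of u v] E_level[of u v] E_iff[of u v] by metis
  then show ?thesis by (simp add: induced_subgraph_def)
qed

lemma connected_level_stack:
  assumes "is_level stack L"
  shows "connected_graph (induced_subgraph stack L)"
proof -
  obtain k where L: "L = {v \<in> V. h v = k}" "L \<noteq> {}" using level_stack[OF assms] .
  have "(\<lambda>u v. D u v \<and> h u = k)\<^sup>*\<^sup>* u v" if "D\<^sup>*\<^sup>* u v" "h u = k" for u v
  proof -
    have "(\<lambda>u v. D u v \<and> h u = k)\<^sup>*\<^sup>* u v \<and> h v = k" using that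
    proof (induction rule: rtranclp_induct)
      case (step y z)
      then show ?case using D_h by (auto intro: rtranclp.rtrancl_into_rtrancl)
    qed simp
    then show ?thesis by simp
  qed
  then show ?thesis
    using L D_connected unfolding L(1) induced_level_stack by (auto simp: connected_graph_def)
qed

lemma weight_stack:
  assumes "u \<in> V" "v \<in> V"
  shows "weight stack u v = 4 powi (h u - h v)"
  using balanced_all[OF assms(2,1)] S_pos[OF assms] by (simp add: weight_def balanced_def)

lemma weight_level:
  assumes "u \<in> V" "is_level stack L"
  shows "\<exists>k. \<forall>v\<in>L. weight stack u v = 4 powi k"
proof -
  obtain k where "L = {v \<in> V. h v = k}" "L \<noteq> {}" using level_stack[OF assms(2)] .
  then have "\<forall>v\<in>L. weight stack u v = 4 powi (h u - k)" using weight_stack[OF assms(1)] by simp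
  then show ?thesis by blast
qed

end

section \<open>Trees with a distinguished end\<close>

text \<open>The 3-regular tree seen from an end: \<open>p\<close> steps towards the end,
  \<open>l\<close> is a Busemann function growing away from it, and \<open>confluent\<close>
  expresses connectedness.\<close>

locale horocyclic_tree =
  fixes p :: "'a \<Rightarrow> 'a" and l :: "'a \<Rightarrow> int"
  assumes l_p: "l (p x) = l x - 1"
    and card_children: "card {y. p y = x} = 2"
    and confluent: "\<exists>m n. (p ^^ m) x = (p ^^ n) y"
    and homogeneous: "\<exists>g. bij g \<and> (\<forall>z. g (p z) = p (g z)) \<and> g x = y"
begin

definition tree :: "'a graph" where
  "tree = \<lparr>verts = UNIV, adj = (\<lambda>x y. y = p x \<or> x = p y)\<rparr>"

lemma verts_tree [simp]: "verts tree = UNIV"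
  by (simp add: tree_def)

lemma adj_tree: "adj tree x y \<longleftrightarrow> y = p x \<or> x = p y"
  by (simp add: tree_def)

lemma l_funpow: "l ((p ^^ n) x) = l x - int n"
  by (induction n) (simp_all add: l_p)

lemma finite_children: "finite {y. p y = x}"
  by (rule card_ge_0_finite) (simp add: card_children)

lemma surj_funpow: "\<exists>y. (p ^^ n) y = x"
proof (induction n arbitrary: x)
  case (Suc n)
  have "{z. p z = x} \<noteq> {}" using card_children[of x] by (metis card.empty zero_neq_numeral)
  then obtain z where "p z = x" by blast
  moreover obtain y where "(p ^^ n) y = z" using Suc by blast
  ultimately show ?case by auto
qed simp

lemma not_p_p: "p (p x) \<noteq> x"
proof
  assume "p (p x) = x"
  then have "l (p (p x)) = l x" by (rule arg_cong)
  then show False by (simp add: l_p)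
qed

lemma simple_tree: "simple_graph tree"
proof -
  have "x \<noteq> p x" for x
  proof
    assume "x = p x"
    then have "l x = l (p x)" by (rule arg_cong)
    then show False by (simp add: l_p)
  qed
  then show ?thesis unfolding simple_graph_def adj_tree by (metis UNIV_I verts_tree)
qed

lemma connected_tree: "connected_graph tree"
proof -
  have up: "(adj tree)\<^sup>*\<^sup>* x ((p ^^ n) x)" for x n
    by (induction n) (auto simp: adj_tree intro: rtranclp.rtrancl_into_rtrancl)
  have down: "(adj tree)\<^sup>*\<^sup>* ((p ^^ n) x) x" for x n
    by (induction n) (auto simp: adj_tree intro: converse_rtranclp_into_rtranclp)
  have "(adj tree)\<^sup>*\<^sup>* x y" for x y
  proof -
    obtain m n where "(p ^^ m) x = (p ^^ n) y" using confluent by blast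
    then show ?thesis using up[of x m] down[of n y] by simp
  qed
  then show ?thesis by (simp add: connected_graph_def)
qed

text \<open>Both neighbours on a cycle of a vertex on the highest layer would be its parent.\<close>

lemma acyclic_tree: "\<not> is_cycle tree xs"
proof
  assume c: "is_cycle tree xs"
  let ?n = "length xs"
  have n: "?n \<ge> 3" and d: "distinct xs" and s: "successively (adj tree) xs"
    and z: "adj tree (last xs) (hd xs)" using c by (auto simp: is_cycle_def)
  have ne: "xs \<noteq> []" using n by auto
  have edge: "adj tree (xs ! i) (xs ! (Suc i mod ?n))" if "i < ?n" for i
  proof (cases "Suc i < ?n")
    case True
    then show ?thesis using s by (simp add: successively_conv_nth)
  next
    case False
    then have "Suc i = ?n" using that by simp
    then have "i = ?n - 1" "Suc i mod ?n = 0" by simp_all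
    then show ?thesis using z ne by (simp add: last_conv_nth hd_conv_nth)
  qed
  define M where "M = Max (l ` set xs)"
  have "M \<in> l ` set xs" unfolding M_def by (rule Max_in) (use ne in auto)
  then obtain i where i: "i < ?n" "l (xs ! i) = M" by (auto simp: in_set_conv_nth)
  have max: "l (xs ! j) \<le> l (xs ! i)" if "j < ?n" for j
    unfolding i(2) M_def using that by (intro Max_ge) auto
  have parent: "xs ! j = p (xs ! i)"
    if "j < ?n" "adj tree (xs ! i) (xs ! j) \<or> adj tree (xs ! j) (xs ! i)" for j
  proof -
    have "xs ! i \<noteq> p (xs ! j)" using max[OF that(1)] l_p[of "xs ! j"] by auto
    then show ?thesis using that(2) unfolding adj_tree by blast
  qed
  \<comment> \<open>The cyclic predecessor of \<open>i\<close>. Since the cycle has at least three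
    vertices, it differs from the cyclic successor.\<close>
  define j where "j = (if i = 0 then ?n - 1 else i - 1)"
  have j: "j < ?n" "Suc j mod ?n = i" using i n by (auto simp: j_def)
  have k: "Suc i mod ?n < ?n" using ne by (intro mod_less_divisor) simp
  have "xs ! j = p (xs ! i)" using parent[OF j(1)] edge[OF j(1)] j(2) by simp
  moreover have "xs ! (Suc i mod ?n) = p (xs ! i)" using parent[OF k] edge[OF i(1)] by simp
  ultimately have "xs ! j = xs ! (Suc i mod ?n)" by (rule trans[OF _ sym])
  then have "j = Suc i mod ?n" by (simp only: nth_eq_iff_index_eq[OF d j(1) k])
  moreover have "j \<noteq> Suc i mod ?n"
    using i(1) n by (cases "Suc i = ?n") (auto simp: j_def)
  ultimately show False by simp
qed

lemma tree_graph_tree: "tree_graph tree"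
  using simple_tree connected_tree acyclic_tree by (simp add: tree_graph_def)

text \<open>The affine layer function covers both factors: \<open>s = -1\<close> turns the tree
  upside down, and \<open>c\<close> accounts for the level of the stack.\<close>

lemma layered_tree:
  assumes s: "s = 1 \<or> s = -1"
  shows "layered_tree s tree (\<lambda>x. c + s * l x)"
proof -
  have "card {y. adj tree x y} = 3 \<and> card {y. adj tree x y \<and> c + s * l y = c + s * l x + s} = 2 \<and>
    card {y. adj tree x y \<and> c + s * l y = c + s * l x - s} = 1" for x
  proof -
    have "{y. adj tree x y} = insert (p x) {y. p y = x}" by (auto simp: adj_tree)
    then have "card {y. adj tree x y} = 3"
      using not_p_p by (simp add: finite_children card_children)
    moreover have "{y. adj tree x y \<and> c + s * l y = c + s * l x + s} = {y. p y = x}"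
      using s by (auto simp: adj_tree l_p)
    moreover have "{y. adj tree x y \<and> c + s * l y = c + s * l x - s} = {p x}"
      using s by (auto simp: adj_tree l_p)
    ultimately show ?thesis by (simp add: card_children)
  qed
  then show ?thesis unfolding layered_tree_def using tree_graph_tree by blast
qed

text \<open>Two vertices have a common ancestor, and \<open>g\<close> preserves the numbers of steps
  to it, hence also the difference of their layers.\<close>

lemma shift:
  assumes "\<And>z. g (p z) = p (g z)"
  obtains c where "\<And>z. l (g z) = l z + c"
proof -
  have g: "g ((p ^^ n) x) = (p ^^ n) (g x)" for n x
    by (induction n) (simp_all add: assms)
  have "l (g z) - l z = l (g x) - l x" for x z
  proof -
    obtain m n where mn: "(p ^^ m) z = (p ^^ n) x" using confluent by blast
    then have "(p ^^ m) (g z) = (p ^^ n) (g x)" using g by metis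
    then have "l ((p ^^ m) (g z)) = l ((p ^^ n) (g x))" "l ((p ^^ m) z) = l ((p ^^ n) x)"
      using mn by simp_all
    then show ?thesis unfolding l_funpow by linarith
  qed
  \<comment> \<open>\<open>undefined\<close> merely serves as a fixed reference vertex.\<close>
  then have "\<And>z. l (g z) = l z + (l (g undefined) - l undefined)" by (simp add: algebra_simps)
  then show ?thesis using that by blast
qed

end

text \<open>Used to move the dyadic model to the natural numbers, the vertex type asked for by
  \<open>isomorphic_to_DL22\<close>.\<close>

lemma horocyclic_tree_transport:
  assumes "horocyclic_tree p l" "bij e"
  shows "horocyclic_tree (\<lambda>x. e (p (inv e x))) (\<lambda>x. l (inv e x))"
proof -
  interpret horocyclic_tree p l by fact
  have ie: "inv e (e x) = x" and ei: "e (inv e y) = y" for x y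
    using assms(2) by (simp_all add: bij_is_inj bij_is_surj surj_f_inv_f)
  let ?p = "\<lambda>x. e (p (inv e x))"
  have pow: "(?p ^^ n) x = e ((p ^^ n) (inv e x))" for n x
    by (induction n) (simp_all add: ie ei)
  show ?thesis
  proof
    show "l (inv e (?p x)) = l (inv e x) - 1" for x by (simp add: ie l_p)
    have "{y. ?p y = x} = e ` {y. p y = inv e x}" for x
      using ie ei by (auto simp: image_iff) metis+
    then show "card {y. ?p y = x} = 2" for x
      using card_children card_image[OF inj_on_subset[OF bij_is_inj[OF assms(2)]]] by simp
    show "\<exists>m n. (?p ^^ m) x = (?p ^^ n) y" for x y
      using confluent[of "inv e x" "inv e y"] pow by metis
    show "\<exists>g. bij g \<and> (\<forall>z. g (?p z) = ?p (g z)) \<and> g x = y" for x y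
    proof -
      obtain g where g: "bij g" "\<forall>z. g (p z) = p (g z)" "g (inv e x) = inv e y"
        using homogeneous by blast
      let ?g = "e \<circ> g \<circ> inv e"
      have "bij ?g" using g(1) assms(2) by (intro bij_comp bij_imp_bij_inv)
      moreover have "?g (?p z) = ?p (?g z)" for z using g(2) by (simp add: ie)
      moreover have "?g x = y" using g(3) by (simp add: ei)
      ultimately show ?thesis by blast
    qed
  qed
qed

text \<open>The vertex \<open>(n, k)\<close> is the dyadic interval from \<open>k / 2 ^ n\<close> to \<open>(k + 1) / 2 ^ n\<close>,
  whose parent is the dyadic interval of twice its length that contains it.\<close>

lemma horocyclic_tree_dyadic:
  "horocyclic_tree (\<lambda>(n, k). (n - 1, k div 2)) (fst :: int \<times> nat \<Rightarrow> int)"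
proof
  let ?p = "\<lambda>(n, k). (n - 1, k div 2) :: int \<times> nat"
  show "fst (?p x) = fst x - 1" for x by (cases x) simp
  have "{y. ?p y = x} = {(fst x + 1, 2 * snd x), (fst x + 1, 2 * snd x + 1)}" for x
  proof -
    obtain n k where x: "x = (n, k)" by fastforce
    have "j div 2 = k \<longleftrightarrow> j = 2 * k \<or> j = 2 * k + 1" for j by presburger
    then show ?thesis unfolding x by (auto simp: set_eq_iff)
  qed
  then show "card {y. ?p y = x} = 2" for x by simp
  have pow: "(?p ^^ m) (n, k) = (n - int m, k div 2 ^ m)" for m n k
    by (induction m) (simp_all add: mult.commute flip: div_mult2_eq)
  show "\<exists>i j. (?p ^^ i) x = (?p ^^ j) y" for x y
  proof -
    obtain n k n' k' where xy: "x = (n, k)" "y = (n', k')" by fastforce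
    have div: "a div 2 ^ (a + i) = 0" for a i :: nat
    proof -
      have "a < 2 ^ a" by simp
      also have "(2::nat) ^ a \<le> 2 ^ (a + i)" by (rule power_increasing) simp_all
      finally show ?thesis by simp
    qed
    \<comment> \<open>\<open>k + k'\<close> halvings send both positions to 0, since
      \<open>a < 2 ^ a\<close>; the extra steps bring the two layers together.\<close>
    have "(?p ^^ (k + (k' + nat (n - n')))) x = (?p ^^ (k' + (k + nat (n' - n)))) y"
      unfolding xy pow div by simp
    then show ?thesis by blast
  qed
  show "\<exists>g. bij g \<and> (\<forall>z. g (?p z) = ?p (g z)) \<and> g x = y" for x y
  proof -
    obtain n k n' k' where xy: "x = (n, k)" "y = (n', k')" by fastforce
    \<comment> \<open>Exclusive or with \<open>c\<close> exchanges \<open>k\<close> and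
      \<open>k'\<close>. \<open>b i\<close> is \<open>c\<close> shifted from layer \<open>n'\<close>
      to layer \<open>i\<close>, so halving takes \<open>b i\<close> to \<open>b (i - 1)\<close> and
      \<open>g\<close> commutes with the parent map.\<close>
    define c where "c = semiring_bit_operations_class.xor k k'"
    define b where "b i = (if i \<le> n' then c div 2 ^ nat (n' - i) else c * 2 ^ nat (i - n'))" for i
    define g where "g = (\<lambda>(i, j). (i + (n' - n), semiring_bit_operations_class.xor j (b (i + (n' - n)))))"
    have b: "b (i - 1) = b i div 2" for i
    proof (cases "i \<le> n'")
      case True
      then have "nat (n' - (i - 1)) = Suc (nat (n' - i))" by simp
      then show ?thesis using True by (simp add: b_def mult.commute flip: div_mult2_eq)
    next
      case False
      then have e: "nat (i - n') = Suc (nat (i - 1 - n'))" by simp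
      have "b i = (c * 2 ^ nat (i - 1 - n')) * 2" unfolding b_def e using False by simp
      then have "b i div 2 = c * 2 ^ nat (i - 1 - n')" by simp
      moreover have "b (i - 1) = c * 2 ^ nat (i - 1 - n')" using False by (auto simp: b_def)
      ultimately show ?thesis by simp
    qed
    have xor_div: "semiring_bit_operations_class.xor j j' div 2 =
      semiring_bit_operations_class.xor (j div 2) (j' div 2)" for j j' :: nat
      using drop_bit_xor[of 1 j j'] by (simp only: drop_bit_eq_div power_one_right)
    \<comment> \<open>\<open>g\<close> uses \<open>b\<close> at the layer where it arrives, so the
      inverse uses it at the layer where it starts.\<close>
    have "bij g"
      by (rule o_bij[where g = "\<lambda>(i, j). (i - (n' - n), semiring_bit_operations_class.xor j (b i))"])
         (auto simp: g_def fun_eq_iff xor.assoc)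
    moreover have "g (?p z) = ?p (g z)" for z
    proof -
      have "fst z - 1 + (n' - n) = fst z + (n' - n) - 1" by simp
      then show ?thesis by (simp only: g_def split_beta fst_conv snd_conv b xor_div)
    qed
    moreover have "g x = y"
      by (simp add: xy g_def b_def c_def flip: xor.assoc)
    ultimately show ?thesis by blast
  qed
qed

section \<open>The product of two opposite trees\<close>

text \<open>Pairs are coded in an abstract type \<open>'v\<close>, so that the vertices can be
  natural numbers.\<close>

locale horocyclic_product = horocyclic_tree p l for p :: "'a \<Rightarrow> 'a" and l +
  fixes pair :: "'a \<Rightarrow> 'a \<Rightarrow> 'v" and a b :: "'v \<Rightarrow> 'a"
  assumes a_pair [simp]: "a (pair x y) = x"
    and b_pair [simp]: "b (pair x y) = y"
    and pair_a_b [simp]: "pair (a v) (b v) = v"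
begin

section \<open>Levels of the product and their connectedness\<close>

definition V :: "'v set" where
  "V = {v. even (l (a v) + l (b v))}"

text \<open>Halved because \<open>P\<close> lowers both layers by 1.\<close>

definition h :: "'v \<Rightarrow> int" where
  "h v = (l (a v) + l (b v)) div 2"

text \<open>With the second tree upside down, a horizontal edge goes to the parent in one coordinate
  and to a child in the other, keeping the sum of the layers.\<close>

definition D :: "'v \<Rightarrow> 'v \<Rightarrow> bool" where
  "D u v \<longleftrightarrow> u \<in> V \<and> v \<in> V \<and>
     (a v = p (a u) \<and> b u = p (b v) \<or> a u = p (a v) \<and> b v = p (b u))"

definition P :: "'v \<Rightarrow> 'v" where
  "P v = pair (p (a v)) (p (b v))"

lemma pair_eq_iff: "pair x y = v \<longleftrightarrow> x = a v \<and> y = b v"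
  by (metis a_pair b_pair pair_a_b)

lemma h_double: "v \<in> V \<Longrightarrow> l (a v) + l (b v) = 2 * h v"
  by (simp add: V_def h_def)

lemma pair_V: "pair x y \<in> V \<longleftrightarrow> even (l x + l y)"
  by (simp add: V_def)

lemma P_in_V: "v \<in> V \<Longrightarrow> P v \<in> V"
  by (simp add: V_def P_def l_p)

text \<open>The first coordinate climbs while the second descends along the prescribed path to
  \<open>z\<close>. The parity hypothesis puts the starting pair into \<open>V\<close>.\<close>

lemma D_connected_climb:
  "even (l x + l z - int m) \<Longrightarrow> D\<^sup>*\<^sup>* (pair x ((p ^^ m) z)) (pair ((p ^^ m) x) z)"
proof (induction m arbitrary: z)
  case (Suc m)
  have "D\<^sup>*\<^sup>* (pair x ((p ^^ m) (p z))) (pair ((p ^^ m) x) (p z))"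
    by (rule Suc.IH) (use Suc.prems in \<open>simp add: l_p algebra_simps\<close>)
  moreover have "D (pair ((p ^^ m) x) (p z)) (pair (p ((p ^^ m) x)) z)"
    using Suc.prems by (simp add: D_def pair_V l_p l_funpow algebra_simps)
  ultimately show ?case by (simp add: funpow_swap1)
qed simp

lemma D_symmetric: "D u v \<Longrightarrow> D v u"
  by (auto simp: D_def)

text \<open>First climb to a common ancestor of the first coordinates, the second ones descending to
  \<open>z\<close> and \<open>w\<close>. Then join \<open>z\<close> to \<open>w\<close> through
  their common ancestor, while the first coordinate descends and climbs back.\<close>

lemma D_level_connected:
  assumes "u \<in> V" "v \<in> V" "h u = h v"
  shows "D\<^sup>*\<^sup>* u v"
proof -
  have sym: "D\<^sup>*\<^sup>* w u" if "D\<^sup>*\<^sup>* u w" for u w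
    using that by (induction rule: rtranclp_induct)
      (auto intro: converse_rtranclp_into_rtranclp D_symmetric)
  obtain m n where mn: "(p ^^ m) (a u) = (p ^^ n) (a v)" using confluent by blast
  obtain z w where z: "(p ^^ m) z = b u" and w: "(p ^^ n) w = b v" using surj_funpow by metis
  have lz: "l z = l (b u) + int m" and lw: "l w = l (b v) + int n"
    using l_funpow[of m z] l_funpow[of n w] z w by simp_all
  have lmn: "l (a u) - int m = l (a v) - int n" using mn l_funpow by metis
  have zw: "l z = l w"
    using lz lw lmn h_double[OF assms(1)] h_double[OF assms(2)] assms(3) by linarith
  \<comment> \<open>\<open>z\<close> and \<open>w\<close> lie on one layer, so they are equally far
    below a common ancestor.\<close>
  obtain r r' where rr: "(p ^^ r) z = (p ^^ r') w" using confluent by blast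
  then have "l z - int r = l w - int r'" using l_funpow by metis
  with zw rr have r: "(p ^^ r) z = (p ^^ r) w" by simp
  \<comment> \<open>A point \<open>r\<close> steps below the common ancestor: both climbs starting
    from \<open>d\<close> end at that ancestor, one above \<open>z\<close> and one above
    \<open>w\<close> as second coordinate.\<close>
  obtain d where d: "(p ^^ r) d = (p ^^ m) (a u)" using surj_funpow by blast
  have ld: "l d = l (a u) - int m + int r" using l_funpow[of r d] l_funpow[of m "a u"] d by simp
  have "l d + l z - int r = l (a u) + l (b u)" "l d + l w - int r = l (a u) + l (b u)"
    using ld lz zw by simp_all
  then have even: "even (l d + l z - int r)" "even (l d + l w - int r)"
    using assms(1) by (simp_all only: V_def mem_Collect_eq)
  have "D\<^sup>*\<^sup>* (pair (a u) (b u)) (pair ((p ^^ m) (a u)) z)"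
    using D_connected_climb[of "a u" z m] z lz assms(1) by (simp add: V_def)
  moreover have "D\<^sup>*\<^sup>* (pair (a v) (b v)) (pair ((p ^^ m) (a u)) w)"
    using D_connected_climb[of "a v" w n] w lw assms(2) mn by (simp add: V_def)
  moreover have "D\<^sup>*\<^sup>* (pair d ((p ^^ r) z)) (pair ((p ^^ m) (a u)) z)"
    using D_connected_climb[OF even(1)] d by simp
  moreover have "D\<^sup>*\<^sup>* (pair d ((p ^^ r) z)) (pair ((p ^^ m) (a u)) w)"
    using D_connected_climb[OF even(2)] d r by simp
  ultimately show ?thesis using sym rtranclp_trans[of D] pair_a_b by metis
qed

section \<open>Symmetries of the product\<close>

definition symmetry :: "('v \<Rightarrow> 'v) \<Rightarrow> bool" where
  "symmetry g \<longleftrightarrow> bij_betw g V V \<and> (\<forall>u\<in>V. g (P u) = P (g u)) \<and>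
     (\<forall>u\<in>V. \<forall>v\<in>V. D (g u) (g v) \<longleftrightarrow> D u v)"

text \<open>Each factor shifts \<open>l\<close> by a constant, so \<open>V\<close> is preserved when
  the total shift is even. The second form exchanges the trees, which interchanges the two cases of
  \<open>D\<close>.\<close>

lemma symmetry_pair:
  assumes g: "bij g" "\<And>z. g (p z) = p (g z)" "\<And>z. l (g z) = l z + c"
    and g': "bij g'" "\<And>z. g' (p z) = p (g' z)" "\<And>z. l (g' z) = l z + c'"
    and even: "even (c + c')"
  shows "symmetry (\<lambda>v. pair (g (a v)) (g' (b v)))" and "symmetry (\<lambda>v. pair (g (b v)) (g' (a v)))"
proof -
  have inj: "g x = g y \<longleftrightarrow> x = y" "g' x = g' y \<longleftrightarrow> x = y" for x y
    using g(1) g'(1) by (simp_all add: bij_is_inj inj_eq)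
  have inv: "g (inv g x) = x" "g' (inv g' x) = x" for x
    using g(1) g'(1) by (simp_all add: bij_is_surj surj_f_inv_f)
  have eq: "g x = p (g y) \<longleftrightarrow> x = p y" "g' x = p (g' y) \<longleftrightarrow> x = p y" for x y
    using inj g(2) g'(2) by metis+
  have V: "even (l (g x) + l (g' y)) \<longleftrightarrow> even (l x + l y)" for x y
    using even by (auto simp: g(3) g'(3))
  have V2: "(even (l (g x)) \<longleftrightarrow> even (l (g' y))) \<longleftrightarrow> (even (l x) \<longleftrightarrow> even (l y))" for x y
    using V[of x y] by simp
  have V': "even (l (inv g x) + l (inv g' y)) \<longleftrightarrow> even (l x + l y)" for x y
    using V[of "inv g x" "inv g' y"] by (simp add: inv)
  have ext: "u = v \<longleftrightarrow> a u = a v \<and> b u = b v" for u v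
    by (metis pair_a_b)
  show "symmetry (\<lambda>v. pair (g (a v)) (g' (b v)))"
    unfolding symmetry_def
  proof (intro conjI ballI)
    show "bij_betw (\<lambda>v. pair (g (a v)) (g' (b v))) V V"
    proof (rule bij_betwI')
      show "\<exists>x\<in>V. y = pair (g (a x)) (g' (b x))" if "y \<in> V" for y
        by (rule bexI[of _ "pair (inv g (a y)) (inv g' (b y))"])
           (use that V' inv in \<open>simp_all add: V_def\<close>)
    qed (simp_all add: pair_eq_iff inj ext V_def V2)
  qed (auto simp: P_def g(2) g'(2) D_def V_def V2 eq)
  show "symmetry (\<lambda>v. pair (g (b v)) (g' (a v)))"
    unfolding symmetry_def
  proof (intro conjI ballI)
    show "bij_betw (\<lambda>v. pair (g (b v)) (g' (a v))) V V"
    proof (rule bij_betwI')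
      show "\<exists>x\<in>V. y = pair (g (b x)) (g' (a x))" if "y \<in> V" for y
        by (rule bexI[of _ "pair (inv g' (b y)) (inv g (a y))"])
           (use that V'[of "a y" "b y"] inv in \<open>simp_all add: V_def add.commute\<close>)
    qed (auto simp: pair_eq_iff inj ext V_def V2)
  qed (auto simp: P_def g(2) g'(2) D_def V_def V2 eq)
qed

lemma symmetry_homogeneous:
  assumes "u \<in> V" "v \<in> V"
  shows "\<exists>g. symmetry g \<and> g u = v"
proof -
  obtain g where g: "bij g" "\<And>z. g (p z) = p (g z)" "g (a u) = a v" using homogeneous by metis
  obtain g' where g': "bij g'" "\<And>z. g' (p z) = p (g' z)" "g' (b u) = b v" using homogeneous by metis
  obtain c where c: "\<And>z. l (g z) = l z + c" using shift[of g] g(2) by blast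
  obtain c' where c': "\<And>z. l (g' z) = l z + c'" using shift[of g'] g'(2) by blast
  have "c + c' = 2 * h v - 2 * h u"
    using c[of "a u", unfolded g(3)] c'[of "b u", unfolded g'(3)]
      h_double[OF assms(1)] h_double[OF assms(2)] by linarith
  then have "symmetry (\<lambda>v. pair (g (a v)) (g' (b v)))"
    by (intro symmetry_pair(1)[OF g(1,2) c g'(1,2) c']) simp
  then show ?thesis using g(3) g'(3) pair_a_b by (intro exI conjI) (assumption, simp)
qed

text \<open>Exchanging the two trees reverses a prescribed edge, because a horizontal edge moves
  towards the end of one tree and away from the end of the other.\<close>

lemma symmetry_flip:
  assumes "D u v"
  shows "\<exists>g. symmetry g \<and> g u = v \<and> g v = u"
proof -
  have *: "\<exists>g. symmetry g \<and> g u = v \<and> g v = u"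
    if "u \<in> V" "v \<in> V" and uv: "a v = p (a u)" "b u = p (b v)" for u v
  proof -
    obtain g where g: "bij g" "\<And>z. g (p z) = p (g z)" "g (b v) = a u" using homogeneous by metis
    obtain g' where g': "bij g'" "\<And>z. g' (p z) = p (g' z)" "g' (a u) = b v" using homogeneous by metis
    obtain c where c: "\<And>z. l (g z) = l z + c" using shift[of g] g(2) by blast
    obtain c' where c': "\<And>z. l (g' z) = l z + c'" using shift[of g'] g'(2) by blast
    \<comment> \<open>\<open>g\<close> and \<open>g'\<close> move between the same two layers in
      opposite directions.\<close>
    have "c + c' = 0" using c[of "b v"] c'[of "a u"] g(3) g'(3) by simp
    then have "symmetry (\<lambda>v. pair (g (b v)) (g' (a v)))"
      by (intro symmetry_pair(2)[OF g(1,2) c g'(1,2) c']) simp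
    \<comment> \<open>\<open>g\<close> and \<open>g'\<close> were prescribed at the child ends only;
      commuting with \<open>p\<close> settles the parent ends.\<close>
    moreover have "pair (g (b u)) (g' (a u)) = v" "pair (g (b v)) (g' (a v)) = u"
      using uv g g' by (simp_all add: pair_eq_iff)
    ultimately show ?thesis by (intro exI conjI)
  qed
  consider "a v = p (a u)" "b u = p (b v)" | "a u = p (a v)" "b v = p (b u)"
    using assms by (auto simp: D_def)
  then show ?thesis
  proof cases
    case 1
    then show ?thesis using * assms by (simp add: D_def)
  next
    case 2
    then have "\<exists>g. symmetry g \<and> g v = u \<and> g u = v" using *[of v u] assms by (simp add: D_def)
    then show ?thesis by blast
  qed
qed

text \<open>On \<open>V\<close> this \<open>f\<close> is half the difference of the two layers: a
  horizontal edge changes it by 1, and \<open>P\<close> lowers both layers equally.\<close>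

sublocale fibred_graph V D P h "\<lambda>v. h v - l (b v)"
proof
  fix u v :: 'v
  obtain x :: 'a where True by blast
  have "pair x x \<in> V" by (simp add: pair_V)
  then show "V \<noteq> {}" by blast
  show D_V: "u \<in> V \<and> v \<in> V" if "D u v"
    using that by (simp add: D_def)
  show "D v u" if "D u v" using that by (rule D_symmetric)
  show hD: "h u = h v" if "D u v"
    using that l_p[of "a u"] l_p[of "a v"] l_p[of "b u"] l_p[of "b v"] by (auto simp: D_def h_def)
  show "odd ((h u - l (b u)) - (h v - l (b v)))" if "D u v"
  proof -
    have "l (b u) = l (b v) - 1 \<or> l (b v) = l (b u) - 1" using that l_p by (auto simp: D_def)
    then show ?thesis using hD[OF that] by auto
  qed
  have "{v. D u v} \<subseteq> (\<lambda>(x, y). pair x y) `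
      ({p (a u)} \<times> {y. p y = b u} \<union> {y. p y = a u} \<times> {p (b u)})"
  proof
    fix v assume "v \<in> {v. D u v}"
    then have "(a v, b v) \<in> {p (a u)} \<times> {y. p y = b u} \<union> {y. p y = a u} \<times> {p (b u)}"
      by (auto simp: D_def)
    then show "v \<in> (\<lambda>(x, y). pair x y) `
      ({p (a u)} \<times> {y. p y = b u} \<union> {y. p y = a u} \<times> {p (b u)})"
      by (rule rev_image_eqI) simp
  qed
  then show "finite {v. D u v}"
    by (rule finite_subset) (simp add: finite_children)
  show "D\<^sup>*\<^sup>* u v" if "u \<in> V" "v \<in> V" "h u = h v" using that by (rule D_level_connected)
  show "P u \<in> V" if "u \<in> V" using that by (rule P_in_V)
  show hP: "h (P u) = h u - 1" if "u \<in> V"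
    using h_double[OF that] h_double[OF P_in_V[OF that]] by (simp add: P_def l_p)
  show "h (P u) - l (b (P u)) = h u - l (b u)" if "u \<in> V"
    using hP[OF that] by (simp add: P_def l_p)
  show "card {u \<in> V. P u = v} = 4" if "v \<in> V"
  proof -
    \<comment> \<open>The fibre is a product of two sets of children, whence 2 * 2 = 4; its pairs
      lie in \<open>V\<close> because their layer sum exceeds that of \<open>v\<close> by 2.\<close>
    have "{u \<in> V. P u = v} = (\<lambda>(x, y). pair x y) ` ({x. p x = a v} \<times> {y. p y = b v})"
    proof (intro equalityI subsetI)
      fix u assume "u \<in> {u \<in> V. P u = v}"
      then have "(a u, b u) \<in> {x. p x = a v} \<times> {y. p y = b v}" by (auto simp: P_def)
      then show "u \<in> (\<lambda>(x, y). pair x y) ` ({x. p x = a v} \<times> {y. p y = b v})"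
        by (rule rev_image_eqI) simp
    next
      fix u assume "u \<in> (\<lambda>(x, y). pair x y) ` ({x. p x = a v} \<times> {y. p y = b v})"
      then obtain x y where u: "u = pair x y" "p x = a v" "p y = b v" by auto
      have "l x + l y = l (a v) + l (b v) + 2" using l_p[of x] l_p[of y] u by simp
      then have "even (l x + l y)" using that by (simp only: V_def mem_Collect_eq) simp
      then show "u \<in> {u \<in> V. P u = v}"
        using u by (simp add: P_def pair_V V_def pair_eq_iff)
    qed
    moreover have "inj_on (\<lambda>(x, y). pair x y) ({x. p x = a v} \<times> {y. p y = b v})"
      by (auto simp: inj_on_def pair_eq_iff)
    ultimately show ?thesis by (simp add: card_image card_cartesian_product card_children)
  qed
  show "\<exists>g. bij_betw g V V \<and> (\<forall>a\<in>V. g (P a) = P (g a)) \<and>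
          (\<forall>a\<in>V. \<forall>b\<in>V. D (g a) (g b) \<longleftrightarrow> D a b) \<and> g u = v" if "u \<in> V" "v \<in> V"
    using symmetry_homogeneous[OF that] unfolding symmetry_def by blast
  show "\<exists>g. bij_betw g V V \<and> (\<forall>a\<in>V. g (P a) = P (g a)) \<and>
          (\<forall>a\<in>V. \<forall>b\<in>V. D (g a) (g b) \<longleftrightarrow> D a b) \<and> g u = v \<and> g v = u" if "D u v"
    using symmetry_flip[OF that] unfolding symmetry_def by blast
qed

text \<open>Reversing the second layer function and shifting it by twice the level turns membership
  in the level into equality of layers.\<close>

lemma level_isomorphic_DL:
  assumes "is_level stack L"
  shows "\<exists>k. isomorphic_graphs (induced_subgraph stack L) (DL_graph tree l tree (\<lambda>x. k - l x))"
proof -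
  obtain k where L: "L = {v \<in> V. h v = k}" "L \<noteq> {}" using level_stack[OF assms] .
  have level: "v \<in> V \<and> h v = k \<longleftrightarrow> l (a v) = 2 * k - l (b v)" for v
    unfolding V_def h_def by auto
  have "bij_betw (\<lambda>v. (a v, b v)) {v. l (a v) = 2 * k - l (b v)} {(x, y). l x = 2 * k - l y}"
    by (rule bij_betw_byWitness[where f' = "\<lambda>(x, y). pair x y"]) auto
  moreover have "D u v \<and> h u = k \<longleftrightarrow> adj tree (a u) (a v) \<and> adj tree (b u) (b v)"
    if "l (a u) = 2 * k - l (b u)" "l (a v) = 2 * k - l (b v)" for u v
  proof -
    have "u \<in> V" "v \<in> V" "h u = k" using that level by blast+
    \<comment> \<open>The layer sum is fixed on a level, so the coordinates cannot both move to
      parents or both to children; the remaining cases are those of \<open>D\<close>.\<close>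
    moreover have "\<not> (a v = p (a u) \<and> b v = p (b u))" "\<not> (a u = p (a v) \<and> b u = p (b v))"
      using that l_p[of "a u"] l_p[of "b u"] l_p[of "a v"] l_p[of "b v"] by auto
    ultimately show ?thesis unfolding D_def adj_tree by blast
  qed
  ultimately have "isomorphic_graphs (induced_subgraph stack L) (DL_graph tree l tree (\<lambda>x. 2 * k - l x))"
    unfolding L(1) induced_level_stack isomorphic_graphs_def DL_graph_def Let_def
    by (intro exI[of _ "\<lambda>v. (a v, b v)"]) (simp add: level)
  then show ?thesis by blast
qed

end

theorem mainTheorem7:
  "\<exists>G :: nat graph.
     transitive_graph G \<and> \<not> unimodular G \<and>
     (\<forall>L. is_level G L \<longrightarrow>
        connected_graph (induced_subgraph G L) \<and>
        isomorphic_to_DL22 (induced_subgraph G L)) \<and>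
     (\<forall>b\<in>verts G. \<exists>c>0. \<forall>L. is_level G L \<longrightarrow>
        (\<exists>k::int. \<forall>x\<in>L. c * weight G b x = 4 powi k))"
proof -
  \<comment> \<open>An enumeration of the dyadic vertices, pairs of an integer and a natural
    number.\<close>
  have "bij (prod_encode \<circ> map_prod int_encode (\<lambda>k. k))"
    by (intro bij_comp bij_prod_encode) (simp add: bij_def prod.inj_map map_prod_surj inj_int_encode surj_int_encode)
  from horocyclic_tree_transport[OF horocyclic_tree_dyadic this]
  obtain p :: "nat \<Rightarrow> nat" and l where "horocyclic_tree p l" by blast
  then interpret horocyclic_tree p l .
  interpret horocyclic_product p l "\<lambda>x y. prod_encode (x, y)"
    "\<lambda>v. fst (prod_decode v)" "\<lambda>v. snd (prod_decode v)"
    by unfold_locales simp_all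
  have DL: "isomorphic_to_DL22 (induced_subgraph stack L)" if "is_level stack L" for L
  proof -
    \<comment> \<open>One tree serves as both factors, with opposite layer functions.\<close>
    have "layered_tree 1 tree l" using layered_tree[of 1 0] by simp
    moreover have "layered_tree (-1) tree (\<lambda>x. k - l x)" for k using layered_tree[of "-1" k] by simp
    ultimately show ?thesis
      unfolding isomorphic_to_DL22_def using level_isomorphic_DL[OF that] by blast
  qed
  show ?thesis
  proof (intro exI[of _ stack] conjI allI impI ballI)
    show "\<exists>c>0. \<forall>L. is_level stack L \<longrightarrow> (\<exists>k::int. \<forall>x\<in>L. c * weight stack b x = 4 powi k)"
      if "b \<in> verts stack" for b
      \<comment> \<open>The base vertex has weight 1, so the constant 1 normalizes the
        weights.\<close>
      using weight_level that by (intro exI[of _ 1]) simp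
  qed (use transitive_stack not_unimodular_stack connected_level_stack DL in blast)+
qed

end
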